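(* The formula $$(rat\wedge\square^*rat)\to\nu x.\,O x$$ of the language $\mathcal{L}_\nu$ is a theorem of (i.e. derivable in) the proof system $\mathbf{P}$.
   Context: Fix $n>1$. The formulae of $\mathcal{L}_\nu$ are given by $$\psi::= rat_i\mid \psi\wedge\psi\mid\neg\psi\mid\square_i\psi\mid O_i\psi\mid x\mid \nu x.\phi\qquad(i\in\{1,\ldots,n\}),$$ where each $rat_i$ is a constant, $x$ is a single set variable, and $\nu x.\phi$ is allowed only if $\phi$ is positive in $x$ (each occurrence of $x$ in $\phi$ is under the scope of an even number of negation signs) and $\nu$-free (contains no occurrence of the $\nu x$ operator). The language $\mathcal{L}$ consists of the formulae containing neither $x$ nor $\nu x$. Abbreviations: $rat:=\bigwedge_{i}rat_i$, $\square\psi:=\bigwedge_i\square_i\psi$, $O\psi:=\bigwedge_iO_i\psi$, $\psi\to\chi:=\neg(\psi\wedge\neg\chi)$, and, for $\psi$ in $\mathcal{L}$, $\square^*\psi:=\nu x.\,\square(x\wedge\psi)$. For a $\nu$-free formula $\psi$, $\psi[x\mapsto\chi]$ is the formula obtained from $\psi$ by substituting each occurrence of $x$ with $\chi$. The proof system $\mathbf{P}$ has, on top of classical propositional reasoning (all instances of propositional tautologies and modus ponens): - axiom schema $rat\,Dis$: $rat\to(\square\psi\to O\psi)$, for all formulae $\psi$; - axiom schema $\nu Dis$: $\nu x.\psi\to\psi[x\mapsto\nu x.\psi]$, for $\psi$ positive in $x$ and $\nu$-free; - rule $\nu Ind$: from $\chi\to\psi[x\mapsto\chi]$ infer $\chi\to\nu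 x.\psi$, for $\psi$ positive in $x$ and $\nu$-free. *)

theory Defs
  imports Main
begin

datatype fm =
    RatI nat
  | Conj fm fm    (infixr \<open>\<^bold>\<and>\<close> 65)
  | Neg fm        (\<open>\<^bold>\<not> _\<close> [70] 70)
  | BoxI nat fm
  | OptI nat fm
  | SVar
  | Nu fm

primrec nu_free :: "fm \<Rightarrow> bool" where
  "nu_free (RatI i) = True"
| "nu_free (\<phi> \<^bold>\<and> \<psi>) = (nu_free \<phi> \<and> nu_free \<psi>)"
| "nu_free (\<^bold>\<not> \<phi>) = nu_free \<phi>"
| "nu_free (BoxI i \<phi>) = nu_free \<phi>"
| "nu_free (OptI i \<phi>) = nu_free \<phi>"
| "nu_free SVar = True"
| "nu_free (Nu \<phi>) = False"

text \<open>The flag records whether the number of negation signs passed so far is even.\<close>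

primrec svar_even :: "bool \<Rightarrow> fm \<Rightarrow> bool" where
  "svar_even e (RatI i) = True"
| "svar_even e (\<phi> \<^bold>\<and> \<psi>) = (svar_even e \<phi> \<and> svar_even e \<psi>)"
| "svar_even e (\<^bold>\<not> \<phi>) = svar_even (\<not> e) \<phi>"
| "svar_even e (BoxI i \<phi>) = svar_even e \<phi>"
| "svar_even e (OptI i \<phi>) = svar_even e \<phi>"
| "svar_even e SVar = e"
| "svar_even e (Nu \<phi>) = svar_even e \<phi>"

definition positive :: "fm \<Rightarrow> bool" where
  "positive \<phi> = svar_even True \<phi>"

text \<open>\<open>wff n \<phi>\<close>: the raw term \<open>\<phi>\<close> is a formula of the language
  \<open>\<L>\<^sub>\<nu>\<close> with indices \<open>1, \<dots>, n\<close>.\<close>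

primrec wff :: "nat \<Rightarrow> fm \<Rightarrow> bool" where
  "wff n (RatI i) = (i \<in> {1..n})"
| "wff n (\<phi> \<^bold>\<and> \<psi>) = (wff n \<phi> \<and> wff n \<psi>)"
| "wff n (\<^bold>\<not> \<phi>) = wff n \<phi>"
| "wff n (BoxI i \<phi>) = (i \<in> {1..n} \<and> wff n \<phi>)"
| "wff n (OptI i \<phi>) = (i \<in> {1..n} \<and> wff n \<phi>)"
| "wff n SVar = True"
| "wff n (Nu \<phi>) = (wff n \<phi> \<and> positive \<phi> \<and> nu_free \<phi>)"

definition Imp :: "fm \<Rightarrow> fm \<Rightarrow> fm"  (infixr \<open>\<^bold>\<longrightarrow>\<close> 55) where
  "\<phi> \<^bold>\<longrightarrow> \<psi> = \<^bold>\<not> (\<phi> \<^bold>\<and> \<^bold>\<not> \<psi>)"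

text \<open>The conjunction \<open>f 1 \<and> (f 2 \<and> \<dots> \<and> f n)\<close>, bracketed to the right;
  the empty conjunction is left unspecified, since only \<open>n > 1\<close> is of interest.\<close>

fun conj_list :: "fm list \<Rightarrow> fm" where
  "conj_list [\<phi>] = \<phi>"
| "conj_list (\<phi> # \<psi> # \<phi>s) = \<phi> \<^bold>\<and> conj_list (\<psi> # \<phi>s)"

definition big_conj :: "nat \<Rightarrow> (nat \<Rightarrow> fm) \<Rightarrow> fm" where
  "big_conj n f = conj_list (map f [1..<Suc n])"

definition Rat :: "nat \<Rightarrow> fm" where
  "Rat n = big_conj n RatI"

definition Box :: "nat \<Rightarrow> fm \<Rightarrow> fm" where
  "Box n \<psi> = big_conj n (\<lambda>i. BoxI i \<psi>)"

definition Opt :: "nat \<Rightarrow> fm \<Rightarrow> fm" where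
  "Opt n \<psi> = big_conj n (\<lambda>i. OptI i \<psi>)"

text \<open>Meant for \<open>\<psi>\<close> containing neither the set variable nor \<open>Nu\<close>;
  otherwise the set variable of \<open>\<psi>\<close> would be captured.\<close>

definition BoxStar :: "nat \<Rightarrow> fm \<Rightarrow> fm" where
  "BoxStar n \<psi> = Nu (Box n (SVar \<^bold>\<and> \<psi>))"

text \<open>\<open>subst \<psi> \<chi>\<close> is \<open>\<psi>[x \<mapsto> \<chi>]\<close>. It is used for
  \<open>\<nu>\<close>-free \<open>\<psi>\<close> only, so the last equation is immaterial.\<close>

primrec subst :: "fm \<Rightarrow> fm \<Rightarrow> fm" where
  "subst (RatI i) \<chi> = RatI i"
| "subst (\<phi> \<^bold>\<and> \<psi>) \<chi> = subst \<phi> \<chi> \<^bold>\<and> subst \<psi> \<chi>"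
| "subst (\<^bold>\<not> \<phi>) \<chi> = \<^bold>\<not> subst \<phi> \<chi>"
| "subst (BoxI i \<phi>) \<chi> = BoxI i (subst \<phi> \<chi>)"
| "subst (OptI i \<phi>) \<chi> = OptI i (subst \<phi> \<chi>)"
| "subst SVar \<chi> = \<chi>"
| "subst (Nu \<phi>) \<chi> = Nu \<phi>"

text \<open>Classical propositional formulae over \<open>\<and>\<close> and \<open>\<not>\<close>, which form
  a complete set of connectives, and their instances in the modal language.\<close>

datatype pfm = PAtom nat | PConj pfm pfm | PNeg pfm

primrec peval :: "(nat \<Rightarrow> bool) \<Rightarrow> pfm \<Rightarrow> bool" where
  "peval v (PAtom p) = v p"
| "peval v (PConj a b) = (peval v a \<and> peval v b)"
| "peval v (PNeg a) = (\<not> peval v a)"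

definition tautology :: "pfm \<Rightarrow> bool" where
  "tautology a = (\<forall>v. peval v a)"

primrec pinst :: "(nat \<Rightarrow> fm) \<Rightarrow> pfm \<Rightarrow> fm" where
  "pinst s (PAtom p) = s p"
| "pinst s (PConj a b) = pinst s a \<^bold>\<and> pinst s b"
| "pinst s (PNeg a) = \<^bold>\<not> pinst s a"

text \<open>Every axiom and conclusion is restricted to formulae of \<open>\<L>\<^sub>\<nu>\<close>.
  In \<open>nuDis\<close> and \<open>nuInd\<close> the side condition on \<open>Nu \<psi>\<close> includes that
  \<open>\<psi>\<close> is positive and \<open>\<nu>\<close>-free.\<close>

inductive provable :: "nat \<Rightarrow> fm \<Rightarrow> bool"  (\<open>_ \<turnstile> _\<close> [51, 51] 50) for n where
  taut: "tautology a \<Longrightarrow> wff n (pinst s a) \<Longrightarrow> n \<turnstile> pinst s a"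
| mp: "n \<turnstile> \<phi> \<^bold>\<longrightarrow> \<psi> \<Longrightarrow> n \<turnstile> \<phi> \<Longrightarrow> n \<turnstile> \<psi>"
| ratDis: "wff n \<psi> \<Longrightarrow> n \<turnstile> Rat n \<^bold>\<longrightarrow> (Box n \<psi> \<^bold>\<longrightarrow> Opt n \<psi>)"
| nuDis: "wff n (Nu \<psi>) \<Longrightarrow> n \<turnstile> Nu \<psi> \<^bold>\<longrightarrow> subst \<psi> (Nu \<psi>)"
| nuInd: "wff n \<chi> \<Longrightarrow> wff n (Nu \<psi>) \<Longrightarrow> n \<turnstile> \<chi> \<^bold>\<longrightarrow> subst \<psi> \<chi> \<Longrightarrow> n \<turnstile> \<chi> \<^bold>\<longrightarrow> Nu \<psi>"

end

theory Submission
  imports Defs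
begin

text \<open>Write \<open>S\<close> for \<open>\<box>\<^sup>* rat\<close>. Unfolding \<open>S\<close> by \<open>\<nu>Dis\<close> gives \<open>S \<longrightarrow> \<box>(S \<and> rat)\<close>, and
  \<open>ratDis\<close> turns this into \<open>S \<and> rat \<longrightarrow> O(S \<and> rat)\<close>, whence \<open>S \<and> rat \<longrightarrow> \<nu>x. O x\<close> by
  \<open>\<nu>Ind\<close>. As \<open>\<box>\<close> and \<open>O\<close> need not respect provable equivalence, the induction hypothesis
  has to be \<open>S \<and> rat\<close> rather than \<open>rat \<and> S\<close>; the conjuncts are swapped only at the end.\<close>

lemma wff_Imp [simp]: "wff n (\<phi> \<^bold>\<longrightarrow> \<psi>) \<longleftrightarrow> wff n \<phi> \<and> wff n \<psi>"
  by (simp add: Imp_def)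

text \<open>The empty list is excluded here and in the analogous lemmas below because
  \<open>conj_list []\<close> is unspecified; \<open>n > 0\<close> later rules it out.\<close>

lemma wff_conj_list:
  "\<phi>s \<noteq> [] \<Longrightarrow> wff n (conj_list \<phi>s) \<longleftrightarrow> (\<forall>\<phi>\<in>set \<phi>s. wff n \<phi>)"
  by (induction \<phi>s rule: conj_list.induct) auto

lemma nu_free_conj_list:
  "\<phi>s \<noteq> [] \<Longrightarrow> nu_free (conj_list \<phi>s) \<longleftrightarrow> (\<forall>\<phi>\<in>set \<phi>s. nu_free \<phi>)"
  by (induction \<phi>s rule: conj_list.induct) auto

lemma svar_even_conj_list:
  "\<phi>s \<noteq> [] \<Longrightarrow> svar_even e (conj_list \<phi>s) \<longleftrightarrow> (\<forall>\<phi>\<in>set \<phi>s. svar_even e \<phi>)"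
  by (induction \<phi>s rule: conj_list.induct) auto

lemma subst_conj_list:
  "\<phi>s \<noteq> [] \<Longrightarrow> subst (conj_list \<phi>s) \<chi> = conj_list (map (\<lambda>\<phi>. subst \<phi> \<chi>) \<phi>s)"
  by (induction \<phi>s rule: conj_list.induct) auto

context
  fixes n :: nat
  assumes n: "n > 0"
begin

lemma indices_nonempty: "map f [1..<Suc n] \<noteq> []"
  using n by simp

lemma ball_indices: "(\<forall>\<phi>\<in>set (map f [1..<Suc n]). P \<phi>) \<longleftrightarrow> (\<forall>i\<in>{1..n}. P (f i))"
  \<comment> \<open>\<open>upt_Suc\<close> would split off the last index before the set of the
    interval is computed.\<close>
  by (auto simp del: upt_Suc)

lemma wff_big_conj: "wff m (big_conj n f) \<longleftrightarrow> (\<forall>i\<in>{1..n}. wff m (f i))"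
  unfolding big_conj_def wff_conj_list[OF indices_nonempty] ball_indices ..

lemma nu_free_big_conj: "nu_free (big_conj n f) \<longleftrightarrow> (\<forall>i\<in>{1..n}. nu_free (f i))"
  unfolding big_conj_def nu_free_conj_list[OF indices_nonempty] ball_indices ..

lemma svar_even_big_conj: "svar_even e (big_conj n f) \<longleftrightarrow> (\<forall>i\<in>{1..n}. svar_even e (f i))"
  unfolding big_conj_def svar_even_conj_list[OF indices_nonempty] ball_indices ..

lemma subst_big_conj: "subst (big_conj n f) \<chi> = big_conj n (\<lambda>i. subst (f i) \<chi>)"
  unfolding big_conj_def subst_conj_list[OF indices_nonempty] by (simp add: comp_def)

lemmas big_conj_simps =
  Rat_def Box_def Opt_def wff_big_conj nu_free_big_conj svar_even_big_conj subst_big_conj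

lemma wff_Rat: "wff n (Rat n)"
  by (simp add: big_conj_simps)

lemma wff_Box: "wff n \<psi> \<Longrightarrow> wff n (Box n \<psi>)"
  by (simp add: big_conj_simps)

lemma wff_Opt: "wff n \<psi> \<Longrightarrow> wff n (Opt n \<psi>)"
  by (simp add: big_conj_simps)

text \<open>The body under \<open>Nu\<close> contains neither negations nor \<open>Nu\<close>, hence
  is positive and \<nu>-free.\<close>

lemma wff_BoxStar_Rat: "wff n (BoxStar n (Rat n))"
  by (simp add: BoxStar_def positive_def big_conj_simps)

lemma wff_Nu_Opt_SVar: "wff n (Nu (Opt n SVar))"
  by (simp add: positive_def big_conj_simps)

lemma subst_Opt_SVar: "subst (Opt n SVar) \<chi> = Opt n \<chi>"
  by (simp add: big_conj_simps)

text \<open>The variable does not occur in \<open>Rat n\<close>, so only the left conjunct changes;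
  this fixes the order of the conjuncts under the box.\<close>

lemma subst_Box_SVar_Rat: "subst (Box n (SVar \<^bold>\<and> Rat n)) \<chi> = Box n (\<chi> \<^bold>\<and> Rat n)"
  by (simp add: big_conj_simps)

end

text \<open>An instance of a propositional tautology followed by two uses of modus ponens. In the
  application \<rho> is \<open>Rat n\<close> and the cut formula \<beta> is a box.\<close>

lemma provable_conj_cut:
  assumes "n \<turnstile> \<alpha> \<^bold>\<longrightarrow> \<beta>" and "n \<turnstile> \<rho> \<^bold>\<longrightarrow> (\<beta> \<^bold>\<longrightarrow> \<gamma>)"
    and "wff n \<alpha>" "wff n \<beta>" "wff n \<gamma>" "wff n \<rho>"
  shows "n \<turnstile> (\<alpha> \<^bold>\<and> \<rho>) \<^bold>\<longrightarrow> \<gamma>"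
proof -
  \<comment> \<open>\<open>imp\<close> mirrors the definition of \<open>Imp\<close>, so that
    instances of \<open>t\<close> are syntactically the intended implications.\<close>
  define imp where "imp a b = PNeg (PConj a (PNeg b))" for a b
  define t where "t = imp (imp (PAtom 0) (PAtom 1))
    (imp (imp (PAtom 2) (imp (PAtom 1) (PAtom 3))) (imp (PConj (PAtom 0) (PAtom 2)) (PAtom 3)))"
  define s where "s = (!) [\<alpha>, \<beta>, \<rho>, \<gamma>]"
  have inst: "pinst s t =
      (\<alpha> \<^bold>\<longrightarrow> \<beta>) \<^bold>\<longrightarrow> ((\<rho> \<^bold>\<longrightarrow> (\<beta> \<^bold>\<longrightarrow> \<gamma>)) \<^bold>\<longrightarrow> ((\<alpha> \<^bold>\<and> \<rho>) \<^bold>\<longrightarrow> \<gamma>))"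
    by (simp add: t_def s_def imp_def Imp_def)
  have "tautology t"
    by (auto simp: tautology_def t_def imp_def)
  then have "n \<turnstile> pinst s t"
    by (rule taut) (use assms in \<open>simp add: inst\<close>)
  with assms(1,2) show ?thesis
    unfolding inst by (blast intro: mp)
qed

text \<open>The swap takes place outside all modal operators, so propositional reasoning
  suffices.\<close>

lemma provable_swap_premise:
  assumes "n \<turnstile> (\<alpha> \<^bold>\<and> \<beta>) \<^bold>\<longrightarrow> \<gamma>" and "wff n \<alpha>" "wff n \<beta>" "wff n \<gamma>"
  shows "n \<turnstile> (\<beta> \<^bold>\<and> \<alpha>) \<^bold>\<longrightarrow> \<gamma>"
proof -
  define imp where "imp a b = PNeg (PConj a (PNeg b))" for a b
  define t where "t = imp (imp (PConj (PAtom 0) (PAtom 1)) (PAtom 2))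
    (imp (PConj (PAtom 1) (PAtom 0)) (PAtom 2))"
  define s where "s = (!) [\<alpha>, \<beta>, \<gamma>]"
  have inst: "pinst s t = ((\<alpha> \<^bold>\<and> \<beta>) \<^bold>\<longrightarrow> \<gamma>) \<^bold>\<longrightarrow> ((\<beta> \<^bold>\<and> \<alpha>) \<^bold>\<longrightarrow> \<gamma>)"
    by (simp add: t_def s_def imp_def Imp_def)
  have "tautology t"
    by (auto simp: tautology_def t_def imp_def)
  then have "n \<turnstile> pinst s t"
    by (rule taut) (use assms in \<open>simp add: inst\<close>)
  with assms(1) show ?thesis
    unfolding inst by (blast intro: mp)
qed

theorem theorem5:
  fixes n :: nat
  assumes "n > 1"
  shows "wff n ((Rat n \<^bold>\<and> BoxStar n (Rat n)) \<^bold>\<longrightarrow> Nu (Opt n SVar)) \<and>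
    n \<turnstile> (Rat n \<^bold>\<and> BoxStar n (Rat n)) \<^bold>\<longrightarrow> Nu (Opt n SVar)"
proof -
  have n: "n > 0" using assms by simp
  define S where "S = BoxStar n (Rat n)"
  note wff_R = wff_Rat[OF n] and wff_N = wff_Nu_Opt_SVar[OF n]
  have wff_S: "wff n S"
    unfolding S_def by (rule wff_BoxStar_Rat[OF n])
  have wff_SR: "wff n (S \<^bold>\<and> Rat n)"
    using wff_S wff_R by simp
  have "n \<turnstile> S \<^bold>\<longrightarrow> Box n (S \<^bold>\<and> Rat n)"
    \<comment> \<open>Unfolding \<open>S\<close> exposes the outer \<open>Nu\<close>, from which
      unification reads off the body.\<close>
    using nuDis[OF wff_S[unfolded S_def BoxStar_def]]
    by (simp add: subst_Box_SVar_Rat[OF n] S_def BoxStar_def)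
  then have "n \<turnstile> (S \<^bold>\<and> Rat n) \<^bold>\<longrightarrow> Opt n (S \<^bold>\<and> Rat n)"
    using ratDis[OF wff_SR] wff_S wff_Box[OF n wff_SR] wff_Opt[OF n wff_SR] wff_R
    by (rule provable_conj_cut)
  then have "n \<turnstile> (S \<^bold>\<and> Rat n) \<^bold>\<longrightarrow> Nu (Opt n SVar)"
    \<comment> \<open>The consequent is literally \<open>subst (Opt n SVar)\<close> at the
      antecedent, as \<open>nuInd\<close> requires.\<close>
    using wff_SR wff_N by (simp add: nuInd subst_Opt_SVar[OF n])
  then have "n \<turnstile> (Rat n \<^bold>\<and> S) \<^bold>\<longrightarrow> Nu (Opt n SVar)"
    using wff_S wff_R wff_N by (rule provable_swap_premise)
  moreover have "wff n ((Rat n \<^bold>\<and> S) \<^bold>\<longrightarrow> Nu (Opt n SVar))"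
    using wff_S wff_R wff_N by simp
  ultimately show ?thesis
    unfolding S_def by simp
qed

end
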